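(* Let $\mu$ be a probability distribution on $\mathbb{R}^{n\times n}$ with bounded support and let $\mathcal M=\operatorname{supp}\mu$. Assume that (i) there is a proper cone $K\subset\mathbb{R}^n$ such that $MK\subset K$ for every $M\in\mathcal M$; and (ii) the singular part $\mu_s$ of $\mu$ with respect to Lebesgue measure on $\mathbb{R}^{n\times n}$ is either $0$ or of the form $\mu_s=p_1\delta_{M_1}+\cdots+p_N\delta_{M_N}$ for some finite $N$, positive numbers $p_1,\dots,p_N$ and matrices $M_1,\dots,M_N\in\mathbb{R}^{n\times n}$. Then the switched linear system $\Sigma_{\mathcal M}$ is absolutely exponentially stable if and only if there exists $\gamma<1$ such that, for every integer $p\ge 1$, the stochastic switched linear system $\Sigma_\mu$ admits a stochastic Lyapunov function of degree $p$ with growth rate at most $\gamma$.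
   Context: A cone in $\mathbb{R}^n$ is a subset closed under multiplication by nonnegative numbers; it is proper if it is closed, convex, has nonempty interior, and is pointed ($x,-x\in K$ implies $x=0$). $\delta_M$ is the Dirac measure at $M$. $\Sigma_{\mathcal M}$ is the switched linear system $x(k+1)=A_kx(k)$, $A_k\in\mathcal M$, $x(0)=x_0\in\mathbb{R}^n$. It is absolutely exponentially stable if there exist $C>0$ and $\gamma\in[0,1)$ such that $\|x(k)\|\le C\gamma^k\|x_0\|$ for every $k\geq 0$, every $\mathcal M$-valued sequence $\{A_k\}_{k=0}^\infty$ and every $x_0$. $\Sigma_\mu$ is the stochastic system $x(k+1)=A_kx(k)$ where the $A_k$ are independent random matrices with distribution $\mu$ and $x(0)=x_0\in\mathbb{R}^n$ is constant. A function $V\colon\mathbb{R}^n\to\mathbb{R}$ is a stochastic Lyapunov function of degree $p$ for $\Sigma_\mu$ with growth rate $\gamma\in[0,1)$ if there exist positive numbers $C_1,C_2$ such that, for every $x\in\mathbb{R}^n$, $C_1\|x\|^p\le V(x)\le C_2\|x\|^p$ and $E[V(Ax)]\le\gamma^pV(x)$, where $A$ is a random matrix with distribution $\mu$. $\|\cdot\|$ on vectors is the Euclidean norm. *)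

theory Defs
  imports "HOL-Probability.Probability"
begin

definition proper_cone :: "(real^'n) set \<Rightarrow> bool" where
  "proper_cone K \<longleftrightarrow>
     cone K \<and> closed K \<and> convex K \<and> interior K \<noteq> {} \<and>
     (\<forall>x. x \<in> K \<and> - x \<in> K \<longrightarrow> x = 0)"

definition support :: "'a::topological_space measure \<Rightarrow> 'a set" where
  "support \<mu> = {x. \<forall>U. open U \<longrightarrow> x \<in> U \<longrightarrow> 0 < emeasure \<mu> U}"

(* There is no addition on the type of measures, so the Lebesgue decomposition
   \<mu> = \<mu>\<^sub>a + \<mu>\<^sub>s, with \<mu>\<^sub>a absolutely continuous and \<mu>\<^sub>s singular, is written
   setwise. For sigma-finite \<mu> exactly one \<mu>\<^sub>s satisfies this predicate. *)
definition is_singular_part :: "'a::euclidean_space measure \<Rightarrow> 'a measure \<Rightarrow> bool" where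
  "is_singular_part \<mu> \<mu>\<^sub>s \<longleftrightarrow>
     sets \<mu>\<^sub>s = sets borel \<and>
     (\<exists>S\<in>sets borel. emeasure lborel S = 0 \<and> emeasure \<mu>\<^sub>s (- S) = 0) \<and>
     (\<exists>\<mu>\<^sub>a. sets \<mu>\<^sub>a = sets borel \<and> absolutely_continuous lborel \<mu>\<^sub>a \<and>
        (\<forall>A\<in>sets borel. emeasure \<mu> A = emeasure \<mu>\<^sub>a A + emeasure \<mu>\<^sub>s A))"

definition is_switched_trajectory ::
    "(real^'n^'n) set \<Rightarrow> (nat \<Rightarrow> real^'n^'n) \<Rightarrow> (nat \<Rightarrow> real^'n) \<Rightarrow> bool" where
  "is_switched_trajectory \<M> A x \<longleftrightarrow>
     (\<forall>k. A k \<in> \<M>) \<and> (\<forall>k. x (Suc k) = A k *v x k)"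

definition absolutely_exponentially_stable :: "(real^'n^'n) set \<Rightarrow> bool" where
  "absolutely_exponentially_stable \<M> \<longleftrightarrow>
     (\<exists>C \<gamma>. 0 < C \<and> 0 \<le> \<gamma> \<and> \<gamma> < 1 \<and>
        (\<forall>A x. is_switched_trajectory \<M> A x \<longrightarrow>
           (\<forall>k. norm (x k) \<le> C * \<gamma> ^ k * norm (x 0))))"

(* The Bochner integral of a non-integrable function is 0 by convention, so
   existence of the expectation E[V(Ax)] has to be required separately. *)
definition stochastic_lyapunov ::
    "(real^'n^'n) measure \<Rightarrow> nat \<Rightarrow> real \<Rightarrow> (real^'n \<Rightarrow> real) \<Rightarrow> bool" where
  "stochastic_lyapunov \<mu> p \<gamma> V \<longleftrightarrow>
     0 \<le> \<gamma> \<and> \<gamma> < 1 \<and>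
     (\<exists>C\<^sub>1 C\<^sub>2. 0 < C\<^sub>1 \<and> 0 < C\<^sub>2 \<and>
        (\<forall>x. C\<^sub>1 * norm x ^ p \<le> V x \<and> V x \<le> C\<^sub>2 * norm x ^ p \<and>
             integrable \<mu> (\<lambda>A. V (A *v x)) \<and>
             (LINT A|\<mu>. V (A *v x)) \<le> \<gamma> ^ p * V x))"

end

theory Submission
  imports Defs
begin

text \<open>If the switched system is stable, the supremum of \<open>norm (x k) / g ^ k\<close> over all trajectories
  starting at \<open>x\<close> is a norm contracted by every matrix of the support, and its powers are Lyapunov
  functions.

  Conversely, let \<open>V\<^sub>p\<close> be a Lyapunov function of degree \<open>p\<close> and \<open>N\<^sub>p\<close> the largest seminorm below
  its \<open>p\<close>-th root. By Jensen, for a ball \<open>B\<close> around a point \<open>M\<close> of the support, the average of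
  \<open>N\<^sub>p (A *v x)\<close> over \<open>A \<in> B\<close> is at most \<open>\<gamma> * \<mu>(B) powr (-1/p) * N\<^sub>p x\<close>, and the factor tends to \<open>\<gamma>\<close>
  as \<open>p\<close> grows. Normalising \<open>N\<^sub>p\<close> on an invariant subspace and passing to the upper limit gives a
  nonzero seminorm contracted by every \<open>M\<close> in the support. Its kernel is a smaller invariant
  subspace, so induction on the dimension assembles an adapted norm on the whole space.\<close>

section \<open>Seminorms on subspaces and their upper limits\<close>

text \<open>Relative to a set, because the induction on the dimension works inside invariant
  subspaces; that \<open>U\<close> is a subspace is assumed separately where vectors must stay in
  it.\<close>

definition seminorm_on :: "'a::real_vector set \<Rightarrow> ('a \<Rightarrow> real) \<Rightarrow> bool" where
  "seminorm_on U N \<longleftrightarrow>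
     (\<forall>x\<in>U. 0 \<le> N x) \<and> (\<forall>x\<in>U. \<forall>y\<in>U. N (x + y) \<le> N x + N y) \<and>
     (\<forall>t. \<forall>x\<in>U. N (t *\<^sub>R x) = \<bar>t\<bar> * N x)"

lemma seminorm_onD:
  assumes "seminorm_on U N"
  shows "x \<in> U \<Longrightarrow> 0 \<le> N x"
    and "x \<in> U \<Longrightarrow> y \<in> U \<Longrightarrow> N (x + y) \<le> N x + N y"
    and "x \<in> U \<Longrightarrow> N (t *\<^sub>R x) = \<bar>t\<bar> * N x"
  using assms by (auto simp: seminorm_on_def)

lemma seminorm_on_subset: "seminorm_on U N \<Longrightarrow> W \<subseteq> U \<Longrightarrow> seminorm_on W N"
  by (auto simp: seminorm_on_def subset_iff)

lemma seminorm_on_zero: "seminorm_on U N \<Longrightarrow> 0 \<in> U \<Longrightarrow> N 0 = 0"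
  using seminorm_onD(3)[of U N 0 0] by simp

lemma seminorm_on_minus: "seminorm_on U N \<Longrightarrow> x \<in> U \<Longrightarrow> N (- x) = N x"
  using seminorm_onD(3)[of U N x "-1"] by simp

lemma seminorm_on_triangle_le:
  assumes "seminorm_on U N" "subspace U" "x \<in> U" "y \<in> U"
  shows "N x \<le> N y + N (x - y)"
  using seminorm_onD(2)[OF assms(1), of y "x - y"] assms by (auto simp: subspace_diff)

lemma seminorm_on_diff:
  assumes "seminorm_on U N" "subspace U" "x \<in> U" "y \<in> U"
  shows "\<bar>N x - N y\<bar> \<le> N (x - y)"
proof -
  have "N (x - y) = N (y - x)"
    using seminorm_on_minus[of U N "x - y"] assms by (auto simp: subspace_diff)
  then show ?thesis
    using seminorm_on_triangle_le[OF assms] seminorm_on_triangle_le[OF assms(1,2,4,3)] by linarith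
qed

lemma seminorm_on_continuous:
  fixes N :: "'a::real_normed_vector \<Rightarrow> real"
  assumes N: "seminorm_on U N" "subspace U" and b: "\<And>x. x \<in> U \<Longrightarrow> N x \<le> C * norm x"
  shows "continuous_on U N"
proof (rule lipschitz_on_continuous_on)
  \<comment> \<open>The sign of \<open>C\<close> is not given, and a Lipschitz constant must be
    nonnegative.\<close>
  show "(max C 0)-lipschitz_on U N"
  proof (rule lipschitz_onI)
    fix x y assume xy: "x \<in> U" "y \<in> U"
    have "\<bar>N x - N y\<bar> \<le> C * norm (x - y)"
      using seminorm_on_diff[OF N xy] b[of "x - y"] xy N(2) by (auto simp: subspace_diff)
    also have "\<dots> \<le> max C 0 * norm (x - y)"
      by (intro mult_right_mono) auto
    finally show "dist (N x) (N y) \<le> max C 0 * dist x y"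
      by (simp add: dist_norm)
  qed simp
qed

lemma compact_sphere_Int_subspace:
  fixes U :: "'a::euclidean_space set"
  shows "subspace U \<Longrightarrow> compact (U \<inter> sphere 0 1)"
  by (simp add: closed_Int_compact closed_subspace)

text \<open>By continuity and compactness \<open>N\<close> has a positive minimum on the unit sphere
  of \<open>U\<close>, and homogeneity carries it to all of \<open>U\<close>. If the sphere is
  empty, \<open>U\<close> is the zero space and any constant works.\<close>

lemma seminorm_on_lower_bound:
  fixes N :: "'a::euclidean_space \<Rightarrow> real"
  assumes N: "seminorm_on U N" "subspace U" and b: "\<And>x. x \<in> U \<Longrightarrow> N x \<le> C * norm x"
    and pos: "\<And>x. x \<in> U \<Longrightarrow> x \<noteq> 0 \<Longrightarrow> 0 < N x"
  obtains c where "0 < c" "\<And>x. x \<in> U \<Longrightarrow> c * norm x \<le> N x"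
proof (cases "U \<inter> sphere 0 1 = {}")
  case True
  have "x = 0" if "x \<in> U" for x
  proof (rule ccontr)
    assume "x \<noteq> 0"
    then have "(1 / norm x) *\<^sub>R x \<in> U \<inter> sphere 0 1"
      using that N(2) by (auto intro: subspace_scale)
    with True show False by blast
  qed
  then show thesis using that[of 1] N seminorm_on_zero[OF N(1)] by (force simp: subspace_0)
next
  case False
  obtain m where m: "m \<in> U \<inter> sphere 0 1" "\<And>y. y \<in> U \<inter> sphere 0 1 \<Longrightarrow> N m \<le> N y"
    using continuous_attains_inf[OF compact_sphere_Int_subspace[OF N(2)] False]
      continuous_on_subset[OF seminorm_on_continuous[OF N b]] by (metis inf_le1)
  show thesis
  proof (rule that)
    show "0 < N m" using m(1) by (intro pos) auto
    fix x assume x: "x \<in> U"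
    show "N m * norm x \<le> N x"
    proof (cases "x = 0")
      case True
      then show ?thesis using seminorm_on_zero[OF N(1)] N(2) by (simp add: subspace_0)
    next
      case False
      then have "N m \<le> N ((1 / norm x) *\<^sub>R x)"
        using x N(2) by (intro m(2)) (auto intro: subspace_scale)
      also have "\<dots> = N x / norm x" using seminorm_onD(3)[OF N(1) x] by simp
      finally show ?thesis using False by (simp add: field_simps)
    qed
  qed
qed

lemma subspace_seminorm_kernel:
  assumes N: "seminorm_on U N" and U: "subspace U"
  shows "subspace {x\<in>U. N x = 0}"
proof (rule subspaceI)
  show "0 \<in> {x\<in>U. N x = 0}" using U seminorm_on_zero[OF N] by (simp add: subspace_0)
  show "x + y \<in> {x\<in>U. N x = 0}" if "x \<in> {x\<in>U. N x = 0}" "y \<in> {x\<in>U. N x = 0}" for x y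
    using that seminorm_onD(2)[OF N, of x y] seminorm_onD(1)[OF N, of "x + y"] U
    by (auto simp: subspace_add)
  show "c *\<^sub>R x \<in> {x\<in>U. N x = 0}" if "x \<in> {x\<in>U. N x = 0}" for c x
    using that seminorm_onD(3)[OF N, of x c] U by (auto simp: subspace_scale)
qed

text \<open>The new seminorm is the pointwise upper limit of the seminorms \<open>F p\<close>, normalised to have
  maximum 1 on the unit sphere of \<open>U\<close>.\<close>

lemma limit_seminorm:
  fixes F :: "nat \<Rightarrow> 'a::euclidean_space \<Rightarrow> real"
  assumes U: "subspace U" "U \<noteq> {0}"
    and F: "\<And>p. seminorm_on U (F p)" "\<And>p x. x \<in> U \<Longrightarrow> F p x \<le> C p * norm x"
      "\<And>p x. x \<in> U \<Longrightarrow> x \<noteq> 0 \<Longrightarrow> 0 < F p x"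
  obtains s N where "\<And>p. 0 < s p" "\<And>p x. x \<in> U \<Longrightarrow> F p x \<le> s p * norm x"
    "seminorm_on U N" "\<And>x. x \<in> U \<Longrightarrow> N x \<le> norm x" "\<exists>x\<in>U. N x \<noteq> 0"
    "\<And>x c. x \<in> U \<Longrightarrow> N x < c \<Longrightarrow> \<forall>\<^sub>F p in sequentially. F p x \<le> s p * c"
    "\<And>x c. x \<in> U \<Longrightarrow> \<forall>\<^sub>F p in sequentially. F p x \<le> s p * c \<Longrightarrow> N x \<le> c"
proof -
  let ?S = "U \<inter> sphere 0 1"
  obtain u where u: "u \<in> U" "u \<noteq> 0" using U by (metis subspace_0 singletonI subsetI subset_antisym singletonD)
  then have ne: "?S \<noteq> {}"
    using U(1) by (auto intro!: exI[of _ "(1 / norm u) *\<^sub>R u"] intro: subspace_scale simp: set_eq_iff)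
  have "\<exists>m\<in>?S. \<forall>y\<in>?S. F p y \<le> F p m" for p
    by (intro continuous_attains_sup[OF compact_sphere_Int_subspace[OF U(1)] ne]
        continuous_on_subset[OF seminorm_on_continuous[OF F(1) U(1) F(2)]]) auto
  then obtain m where m: "\<And>p. m p \<in> ?S" "\<And>p y. y \<in> ?S \<Longrightarrow> F p y \<le> F p (m p)" by metis
  define s where "s p = F p (m p)" for p
  have s: "0 < s p" for p
  proof -
    have "m p \<in> U" "m p \<noteq> 0" using m(1)[of p] by auto
    then show ?thesis unfolding s_def by (rule F(3))
  qed
  have Fs: "F p x \<le> s p * norm x" if x: "x \<in> U" for p x
  proof (cases "x = 0")
    case True
    then show ?thesis using seminorm_on_zero[OF F(1)] U(1) by (simp add: subspace_0)
  next
    case False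
    then have "F p ((1 / norm x) *\<^sub>R x) \<le> s p"
      using x U(1) unfolding s_def by (intro m(2)) (auto intro: subspace_scale)
    then show ?thesis using False seminorm_onD(3)[OF F(1) x] by (simp add: field_simps)
  qed
  \<comment> \<open>The infimum of the eventual upper bounds in \<open>E x\<close> is the upper
    limit of \<open>F p x / s p\<close>; this form yields the last two conclusions directly as
    \<open>N2\<close> and \<open>N1\<close>.\<close>
  define E where "E x = {c. \<forall>\<^sub>F p in sequentially. F p x \<le> s p * c}" for x
  define N where "N x = Inf (E x)" for x
  have Epos: "0 \<le> c" if "x \<in> U" "c \<in> E x" for x c
  proof -
    have "\<forall>\<^sub>F p in sequentially. F p x \<le> s p * c" using that by (simp add: E_def)
    then obtain p where "F p x \<le> s p * c" by (auto simp: eventually_sequentially)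
    then have "0 \<le> s p * c" using seminorm_onD(1)[OF F(1)[of p] that(1)] by linarith
    then show ?thesis using s[of p] by (simp add: zero_le_mult_iff)
  qed
  have bdd: "bdd_below (E x)" if "x \<in> U" for x by (rule bdd_belowI) (rule Epos[OF that])
  have normE: "norm x \<in> E x" if "x \<in> U" for x using Fs[OF that] by (simp add: E_def)
  have N1: "N x \<le> c" if "x \<in> U" "c \<in> E x" for x c
    unfolding N_def by (rule cInf_lower[OF that(2) bdd[OF that(1)]])
  have N2: "c \<in> E x" if x: "x \<in> U" and c: "N x < c" for x c
  proof -
    obtain c' where c': "c' \<in> E x" "c' < c"
      using cInf_lessD[of "E x" c] normE[OF x] c by (auto simp: N_def)
    then show ?thesis unfolding E_def mem_Collect_eq
      by (elim eventually_mono) (meson less_imp_le mult_left_mono order_trans s)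
  qed
  have N0: "0 \<le> N x" if "x \<in> U" for x
    unfolding N_def using normE[OF that] Epos[OF that] by (intro cInf_greatest) auto
  have sub: "N (x + y) \<le> N x + N y" if "x \<in> U" "y \<in> U" for x y
  proof (rule field_le_epsilon)
    fix e :: real assume "0 < e"
    then have "N x + e/2 \<in> E x" "N y + e/2 \<in> E y" using that by (auto intro!: N2)
    then have "\<forall>\<^sub>F p in sequentially. F p x \<le> s p * (N x + e/2) \<and> F p y \<le> s p * (N y + e/2)"
      by (auto simp: E_def intro: eventually_conj)
    then have "N x + N y + e \<in> E (x + y)" unfolding E_def mem_Collect_eq
    proof (rule eventually_mono)
      fix p assume "F p x \<le> s p * (N x + e/2) \<and> F p y \<le> s p * (N y + e/2)"
      moreover have "s p * (N x + e/2) + s p * (N y + e/2) = s p * (N x + N y + e)"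
        by (simp add: algebra_simps)
      ultimately show "F p (x + y) \<le> s p * (N x + N y + e)"
        using seminorm_onD(2)[OF F(1)[of p] that] by linarith
    qed
    then show "N (x + y) \<le> N x + N y + e" using that U(1) by (intro N1) (auto intro: subspace_add)
  qed
  have scale_le: "N (t *\<^sub>R x) \<le> \<bar>t\<bar> * N x" if x: "x \<in> U" for t x
  proof (cases "t = 0")
    case True
    have "0 \<in> E 0" using seminorm_on_zero[OF F(1)] U(1) by (simp add: E_def subspace_0)
    then show ?thesis using True N1[of 0 0] U(1) by (simp add: subspace_0)
  next
    case False
    show ?thesis
    proof (rule field_le_epsilon)
      fix e :: real assume "0 < e"
      then have "N x + e / \<bar>t\<bar> \<in> E x" using False x by (intro N2) auto
      then have "\<bar>t\<bar> * N x + e \<in> E (t *\<^sub>R x)" unfolding E_def mem_Collect_eq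
      proof (rule eventually_mono)
        fix p assume "F p x \<le> s p * (N x + e / \<bar>t\<bar>)"
        then have "\<bar>t\<bar> * F p x \<le> \<bar>t\<bar> * (s p * (N x + e / \<bar>t\<bar>))" by (intro mult_left_mono) auto
        also have "\<dots> = s p * (\<bar>t\<bar> * N x + e)" using False by (simp add: field_simps)
        finally show "F p (t *\<^sub>R x) \<le> s p * (\<bar>t\<bar> * N x + e)"
          using seminorm_onD(3)[OF F(1) x] by simp
      qed
      then show "N (t *\<^sub>R x) \<le> \<bar>t\<bar> * N x + e" using x U(1) by (intro N1) (auto intro: subspace_scale)
    qed
  qed
  have scale: "N (t *\<^sub>R x) = \<bar>t\<bar> * N x" if x: "x \<in> U" for t x
  proof (rule antisym[OF scale_le[OF x]])
    show "\<bar>t\<bar> * N x \<le> N (t *\<^sub>R x)"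
    proof (cases "t = 0")
      case True
      then show ?thesis using N0[of 0] U(1) by (simp add: subspace_0)
    next
      case False
      then show ?thesis using scale_le[of "t *\<^sub>R x" "1 / t"] x U(1)
        by (simp add: subspace_scale field_simps)
    qed
  qed
  \<comment> \<open>The maximisers \<open>m p\<close> subconverge to some \<open>l\<close>. If
    \<open>N l = 0\<close>, then along the subsequence \<open>F\<close> at \<open>l\<close> is at
    most half of \<open>s\<close>, and the distance from \<open>m\<close> to \<open>l\<close>
    contributes strictly less than the other half, so \<open>F\<close> could not reach its maximum
    \<open>s\<close> at \<open>m\<close>.\<close>
  obtain l r where l: "l \<in> ?S" "strict_mono r" "(m \<circ> r) \<longlonglongrightarrow> l"
    using compact_sphere_Int_subspace[OF U(1)] m(1) unfolding compact_def by metis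
  have "N l \<noteq> 0"
  proof
    assume "N l = 0"
    then have "1/2 \<in> E l" using l(1) by (intro N2) auto
    then have "\<forall>\<^sub>F p in sequentially. F (r p) l \<le> s (r p) * (1/2)"
      unfolding E_def mem_Collect_eq by (rule eventually_subseq[OF l(2)])
    moreover have "\<forall>\<^sub>F p in sequentially. dist ((m \<circ> r) p) l < 1/2"
      using l(3) by (rule tendstoD) simp
    ultimately have "\<forall>\<^sub>F p in sequentially. False"
    proof eventually_elim
      case (elim p)
      let ?q = "r p"
      have mU: "m ?q \<in> U" and lU: "l \<in> U" using m(1) l(1) by auto
      have "s ?q \<le> F ?q l + F ?q (m ?q - l)" unfolding s_def
        by (rule seminorm_on_triangle_le[OF F(1) U(1) mU lU])
      also have "F ?q (m ?q - l) \<le> s ?q * norm (m ?q - l)"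
        using mU lU U(1) by (intro Fs) (auto intro: subspace_diff)
      also have "\<dots> < s ?q * (1/2)"
        using elim(2) s[of ?q] by (intro mult_strict_left_mono) (auto simp: dist_norm)
      finally show False using elim(1) by simp
    qed
    then show False by simp
  qed
  then have "\<exists>x\<in>U. N x \<noteq> 0" using l(1) by auto
  moreover have "seminorm_on U N" using N0 sub scale by (auto simp: seminorm_on_def)
  ultimately show thesis
    using N1 N2 normE by (intro that[of s N]) (auto simp: s Fs E_def)
qed

section \<open>The action of matrices and orthogonal projection\<close>

lemma bounded_bilinear_matrix_vector_mult:
  "bounded_bilinear (\<lambda>(A :: real^'n^'m) x. A *v x)"
  unfolding bilinear_conv_bounded_bilinear[symmetric] bilinear_def
  by (auto intro!: linearI simp: matrix_vector_mult_add_rdistrib matrix_vector_right_distrib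
      scaleR_matrix_vector_assoc matrix_vector_mult_scaleR)

lemma matrix_vector_mult_norm_bound:
  obtains K where "0 < K" "\<And>(A :: real^'n^'m) x. norm (A *v x) \<le> norm A * norm x * K"
  using bounded_bilinear.pos_bounded[OF bounded_bilinear_matrix_vector_mult] by metis

lemma orthogonal_projection:
  fixes W :: "'a::euclidean_space set"
  assumes W: "subspace W"
  obtains \<pi> where "\<And>x. \<pi> x \<in> W" "\<And>x w. w \<in> W \<Longrightarrow> orthogonal (x - \<pi> x) w"
    "\<And>x y. \<pi> (x + y) = \<pi> x + \<pi> y" "\<And>x. norm (\<pi> x) \<le> norm x"
proof -
  have "\<exists>y. y \<in> W \<and> (\<forall>w\<in>W. orthogonal (x - y) w)" for x
  proof -
    obtain y z where "y \<in> span W" "\<And>w. w \<in> span W \<Longrightarrow> orthogonal z w" "x = y + z"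
      using orthogonal_subspace_decomp_exists[of W x] by blast
    moreover have "span W = W" using W by (simp add: span_eq_iff)
    ultimately show ?thesis by (intro exI[of _ y]) auto
  qed
  then obtain \<pi> where \<pi>: "\<And>x. \<pi> x \<in> W" "\<And>x w. w \<in> W \<Longrightarrow> orthogonal (x - \<pi> x) w" by metis
  have "\<pi> (x + y) = \<pi> x + \<pi> y" for x y
  proof -
    let ?d = "\<pi> x + \<pi> y - \<pi> (x + y)"
    have d: "?d \<in> W" using \<pi>(1) W by (simp add: subspace_add subspace_diff)
    \<comment> \<open>The right side combines vectors orthogonal to \<open>W\<close>, while
      \<open>?d\<close> lies in \<open>W\<close>, so \<open>?d\<close> is orthogonal to
      itself.\<close>
    have "?d = (x + y - \<pi> (x + y)) - (x - \<pi> x) - (y - \<pi> y)" by simp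
    then have "orthogonal ?d ?d"
      using \<pi>(2)[OF d, of "x + y"] \<pi>(2)[OF d, of x] \<pi>(2)[OF d, of y]
      by (simp add: orthogonal_def inner_diff_left inner_add_left)
    then show ?thesis by (simp add: orthogonal_def)
  qed
  moreover have "norm (\<pi> x) \<le> norm x" for x
  proof (rule power2_le_imp_le)
    have "(norm x)\<^sup>2 = (norm (x - \<pi> x))\<^sup>2 + (norm (\<pi> x))\<^sup>2"
      using norm_add_Pythagorean[OF \<pi>(2)[OF \<pi>(1)], of x x] by simp
    then show "(norm (\<pi> x))\<^sup>2 \<le> (norm x)\<^sup>2" by simp
  qed simp
  ultimately show thesis using that \<pi> by blast
qed

section \<open>Adapted norms by induction on the dimension\<close>

text \<open>An adapted norm with homogeneity left out: comparability with \<open>norm\<close> turns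
  contraction of \<open>L\<close> into decay of trajectories, and subadditivity serves the extension
  from a kernel to the whole subspace.\<close>

definition adapted_bound ::
    "(real^'n^'n) set \<Rightarrow> (real^'n) set \<Rightarrow> real \<Rightarrow> (real^'n \<Rightarrow> real) \<Rightarrow> bool" where
  "adapted_bound S U g L \<longleftrightarrow>
     (\<exists>c C. 0 < c \<and> 0 < C \<and> (\<forall>x\<in>U. c * norm x \<le> L x \<and> L x \<le> C * norm x)) \<and>
     (\<forall>x\<in>U. \<forall>y\<in>U. L (x + y) \<le> L x + L y) \<and>
     (\<forall>M\<in>S. \<forall>x\<in>U. L (M *v x) \<le> g * L x)"

text \<open>For each large \<open>p\<close> only some \<open>A\<close> near \<open>M\<close>,
  depending on \<open>p\<close>, is known to contract \<open>F p\<close> at \<open>x\<close>.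
  Replacing \<open>A\<close> by \<open>M\<close> costs at most \<open>s p\<close> times a small
  multiple of \<open>norm x\<close>, an error that stays small after division by \<open>s p\<close>
  and disappears as \<open>e\<close> tends to 0.\<close>

lemma limit_seminorm_contraction:
  fixes S :: "(real^'n^'n) set"
  assumes U: "subspace U" and inv: "\<And>M x. M \<in> S \<Longrightarrow> x \<in> U \<Longrightarrow> M *v x \<in> U"
    and F: "\<And>p. seminorm_on U (F p)"
    and near: "\<And>M e x. M \<in> S \<Longrightarrow> 0 < e \<Longrightarrow> x \<in> U \<Longrightarrow>
      \<forall>\<^sub>F p in sequentially. \<exists>A\<in>S. dist A M < e \<and> F p (A *v x) \<le> \<kappa> * F p x"
    and \<kappa>: "0 \<le> \<kappa>"
    and s: "\<And>p. 0 < s p" "\<And>p x. x \<in> U \<Longrightarrow> F p x \<le> s p * norm x"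
    and up: "\<And>x c. x \<in> U \<Longrightarrow> N x < c \<Longrightarrow> \<forall>\<^sub>F p in sequentially. F p x \<le> s p * c"
    and low: "\<And>x c. x \<in> U \<Longrightarrow> \<forall>\<^sub>F p in sequentially. F p x \<le> s p * c \<Longrightarrow> N x \<le> c"
    and M: "M \<in> S" and x: "x \<in> U"
  shows "N (M *v x) \<le> \<kappa> * N x"
proof (rule field_le_epsilon)
  fix e :: real assume e: "0 < e"
  obtain K where K: "0 < K" "\<And>(A :: real^'n^'n) x. norm (A *v x) \<le> norm A * norm x * K"
    by (rule matrix_vector_mult_norm_bound) blast
  \<comment> \<open>Half of \<open>e\<close> pays for moving from \<open>A\<close> to
    \<open>M\<close>, the other half for using \<open>N x + \<eta>\<close> in place of
    \<open>N x\<close>. The summand 1 in the denominators covers \<open>x = 0\<close> and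
    \<open>\<kappa> = 0\<close>.\<close>
  define \<delta> where "\<delta> = e / 2 / (K * (1 + norm x))"
  define \<eta> where "\<eta> = e / 2 / (1 + \<kappa>)"
  have nx: "0 < 1 + norm x" by (simp add: add_pos_nonneg)
  have \<delta>0: "0 < \<delta>" using e K(1) nx by (simp add: \<delta>_def)
  have "\<delta> * norm x * K \<le> \<delta> * (1 + norm x) * K"
    using \<delta>0 K(1) by (intro mult_right_mono mult_left_mono) auto
  also have "\<dots> = e / 2" using K(1) nx by (simp add: \<delta>_def)
  finally have \<delta>: "0 < \<delta>" "\<delta> * norm x * K \<le> e / 2" using \<delta>0 by auto
  have \<eta>: "0 < \<eta>" "\<kappa> * \<eta> \<le> e / 2"
    using e \<kappa> by (auto simp: \<eta>_def field_simps)
  have "\<forall>\<^sub>F p in sequentially. F p x \<le> s p * (N x + \<eta>)" using x \<eta> by (intro up) auto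
  moreover note near[OF M \<delta>(1) x]
  ultimately have "\<forall>\<^sub>F p in sequentially. F p (M *v x) \<le> s p * (\<kappa> * N x + e)"
  proof eventually_elim
    case (elim p)
    then obtain A where A: "A \<in> S" "dist A M < \<delta>" "F p (A *v x) \<le> \<kappa> * F p x" by blast
    have "norm (M *v x - A *v x) = norm ((M - A) *v x)" by (simp add: algebra_simps)
    also have "\<dots> \<le> norm (M - A) * norm x * K" by (rule K)
    also have "\<dots> \<le> \<delta> * norm x * K"
      using A(2) K(1) by (intro mult_right_mono) (auto simp: dist_norm norm_minus_commute)
    finally have d: "norm (M *v x - A *v x) \<le> e / 2" using \<delta>(2) by linarith
    have "F p (M *v x) \<le> F p (A *v x) + F p (M *v x - A *v x)"
      by (intro seminorm_on_triangle_le[OF F U] inv M A x)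
    also have "F p (M *v x - A *v x) \<le> s p * norm (M *v x - A *v x)"
      by (intro s subspace_diff U inv M A x)
    also have "\<dots> \<le> s p * (e / 2)" using s(1)[of p] d by (intro mult_left_mono) auto
    also have "F p (A *v x) \<le> \<kappa> * (s p * (N x + \<eta>))"
      using A(3) mult_left_mono[OF elim(1) \<kappa>] by linarith
    also have "\<dots> = s p * (\<kappa> * N x + \<kappa> * \<eta>)" by (simp add: algebra_simps)
    also have "\<dots> \<le> s p * (\<kappa> * N x + e / 2)" using s(1)[of p] \<eta> by (intro mult_left_mono) auto
    finally show ?case by (simp add: algebra_simps)
  qed
  then show "N (M *v x) \<le> \<kappa> * N x + e" by (intro low inv M x)
qed

text \<open>Relative to the kernel \<open>W\<close> of the contracting seminorm \<open>N\<close>, the matrices are block triangular,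
  so a large multiple of \<open>N\<close> absorbs the off-diagonal block.\<close>

lemma adapted_bound_extend:
  fixes S :: "(real^'n^'n) set"
  assumes U: "subspace U" and inv: "\<And>M x. M \<in> S \<Longrightarrow> x \<in> U \<Longrightarrow> M *v x \<in> U"
    and S: "bounded S"
    and N: "seminorm_on U N" "\<And>x. x \<in> U \<Longrightarrow> N x \<le> norm x"
      "\<And>M x. M \<in> S \<Longrightarrow> x \<in> U \<Longrightarrow> N (M *v x) \<le> \<kappa> * N x"
    and \<kappa>: "0 \<le> \<kappa>" "\<kappa> < 1"
    and W_def: "W = {x\<in>U. N x = 0}"
    and L: "0 \<le> g" "g < 1" "adapted_bound S W g L"
  obtains g' L' where "0 \<le> g'" "g' < 1" "adapted_bound S U g' L'"
proof -
  have WU: "W \<subseteq> U" by (auto simp: W_def)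
  have N0: "0 \<le> N x" if "x \<in> U" for x by (rule seminorm_onD(1)[OF N(1) that])
  have W: "subspace W" unfolding W_def by (rule subspace_seminorm_kernel[OF N(1) U])
  have invW: "M *v x \<in> W" if "M \<in> S" "x \<in> W" for M x
    using that N(3)[of M x] N0[of "M *v x"] inv[of M x] by (auto simp: W_def)
  obtain \<pi> where \<pi>: "\<And>x. \<pi> x \<in> W" "\<And>x w. w \<in> W \<Longrightarrow> orthogonal (x - \<pi> x) w"
    "\<And>x y. \<pi> (x + y) = \<pi> x + \<pi> y" "\<And>x. norm (\<pi> x) \<le> norm x"
    using orthogonal_projection[OF W] by metis
  have \<pi>W: "\<pi> w = w" if "w \<in> W" for w
  proof -
    have "orthogonal (w - \<pi> w) (w - \<pi> w)" using that \<pi>(1) W by (intro \<pi>(2)) (auto intro: subspace_diff)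
    then show ?thesis by (simp add: orthogonal_def)
  qed
  \<comment> \<open>\<open>Z\<close> is the orthogonal complement of \<open>W\<close> inside
    \<open>U\<close>. It meets the kernel only in 0, so \<open>N\<close> is a norm there and
    dominates a multiple \<open>b\<close> of the Euclidean one.\<close>
  define Z where "Z = {z\<in>U. \<forall>w\<in>W. orthogonal z w}"
  have Z: "subspace Z" unfolding Z_def
    using U by (auto intro!: subspaceI simp: subspace_0 subspace_add subspace_scale orthogonal_def
      inner_add_left)
  have ZU: "Z \<subseteq> U" by (auto simp: Z_def)
  have NZ: "0 < N z" if "z \<in> Z" "z \<noteq> 0" for z
  proof -
    have "z \<notin> W" using that by (auto simp: Z_def orthogonal_def)
    then show ?thesis using that ZU N0[of z] by (force simp: W_def)
  qed
  obtain b where b: "0 < b" "\<And>z. z \<in> Z \<Longrightarrow> b * norm z \<le> N z"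
    using seminorm_on_lower_bound[OF seminorm_on_subset[OF N(1) ZU] Z, of 1] N(2) ZU NZ by auto
  have xZ: "x - \<pi> x \<in> Z" if "x \<in> U" for x
    using that \<pi> WU U by (auto simp: Z_def intro!: subspace_diff)
  have Nz: "N (x - \<pi> x) = N x" if "x \<in> U" for x
  proof -
    have "\<pi> x \<in> U" "N (\<pi> x) = 0" using \<pi>(1)[of x] by (auto simp: W_def)
    then show ?thesis
      using seminorm_on_diff[OF N(1) U, of x "x - \<pi> x"] that U by (auto simp: subspace_diff)
  qed
  obtain c C where cC: "0 < c" "0 < C" "\<And>x. x \<in> W \<Longrightarrow> c * norm x \<le> L x"
      "\<And>x. x \<in> W \<Longrightarrow> L x \<le> C * norm x"
    and Ladd: "\<And>x y. x \<in> W \<Longrightarrow> y \<in> W \<Longrightarrow> L (x + y) \<le> L x + L y"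
    and LS: "\<And>M x. M \<in> S \<Longrightarrow> x \<in> W \<Longrightarrow> L (M *v x) \<le> g * L x"
    using L(3) unfolding adapted_bound_def by auto
  obtain B where B: "0 < B" "\<And>M. M \<in> S \<Longrightarrow> norm M \<le> B"
    using S by (auto simp: bounded_pos)
  obtain K where K: "0 < K" "\<And>(A :: real^'n^'n) x. norm (A *v x) \<le> norm A * norm x * K"
    by (rule matrix_vector_mult_norm_bound) blast
  \<comment> \<open>\<open>D\<close> bounds the off-diagonal block: the part of
    \<open>M *v z\<close> that falls into \<open>W\<close>, for \<open>z\<close> in
    \<open>Z\<close>, has \<open>L\<close>-size at most \<open>D * N z\<close>.\<close>
  define D where "D = C * B * K / b"
  \<comment> \<open>Chosen so that the off-diagonal term is at most
    \<open>(1 - \<kappa>) / 2\<close> times \<open>\<Lambda> * N x\<close>. Together with the factor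
    \<open>\<kappa>\<close> from the contraction of \<open>N\<close> this makes
    \<open>(1 + \<kappa>) / 2 < 1\<close>. The summand 1 gives
    \<open>1 \<le> \<Lambda>\<close>.\<close>
  define \<Lambda> where "\<Lambda> = 2 * D / (1 - \<kappa>) + 1"
  define L' where "L' x = L (\<pi> x) + \<Lambda> * N x" for x
  have D: "0 < D" using cC B K b by (auto simp: D_def)
  have \<Lambda>: "1 \<le> \<Lambda>" using D \<kappa> by (auto simp: \<Lambda>_def)
  have D\<Lambda>_eq: "(1 - \<kappa>) / 2 * \<Lambda> = D + (1 - \<kappa>) / 2" using \<kappa> by (simp add: \<Lambda>_def distrib_left)
  have D\<Lambda>: "D \<le> (1 - \<kappa>) / 2 * \<Lambda>" unfolding D\<Lambda>_eq using \<kappa> by simp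
  define g' where "g' = max g ((1 + \<kappa>) / 2)"
  have "adapted_bound S U g' L'"
    unfolding adapted_bound_def
  proof (intro conjI ballI)
    \<comment> \<open>From \<open>norm x \<le> L (\<pi> x) / c + N x / b\<close>, where both
      numerators are at most \<open>L' x\<close>.\<close>
    define c' where "c' = 1 / (1 / c + 1 / b)"
    have c': "0 < c'" using cC b by (auto simp: c'_def intro!: add_pos_pos)
    show "\<exists>c C. 0 < c \<and> 0 < C \<and> (\<forall>x\<in>U. c * norm x \<le> L' x \<and> L' x \<le> C * norm x)"
    proof (rule exI[of _ c'], rule exI[of _ "C + \<Lambda>"], intro conjI ballI)
      fix x assume x: "x \<in> U"
      have LN: "0 \<le> L (\<pi> x)" using cC(1) cC(3)[OF \<pi>(1)[of x]] by (meson mult_nonneg_nonneg norm_ge_zero order_trans less_imp_le)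
      have "norm x \<le> norm (\<pi> x) + norm (x - \<pi> x)" using norm_triangle_ineq[of "\<pi> x" "x - \<pi> x"] by simp
      also have "norm (\<pi> x) \<le> L (\<pi> x) / c" using cC(1) cC(3)[OF \<pi>(1)[of x]] by (simp add: field_simps)
      also have "norm (x - \<pi> x) \<le> N x / b" using b(1) b(2)[OF xZ[OF x]] Nz[OF x] by (simp add: field_simps)
      also have "L (\<pi> x) / c \<le> L' x / c"
        using cC(1) N0[OF x] \<Lambda> by (intro divide_right_mono) (auto simp: L'_def)
      also have "N x / b \<le> L' x / b"
        using b(1) LN mult_right_mono[OF \<Lambda> N0[OF x]] by (intro divide_right_mono) (auto simp: L'_def)
      also have "L' x / c + L' x / b = L' x / c'"  unfolding c'_def using cC(1) b(1) by (simp add: field_simps)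
      finally show "c' * norm x \<le> L' x" using c' by (simp add: field_simps)
      have "L (\<pi> x) \<le> C * norm x" using cC(4)[OF \<pi>(1)[of x]] cC(2) \<pi>(4)[of x]
        by (meson mult_left_mono less_imp_le order_trans)
      moreover have "\<Lambda> * N x \<le> \<Lambda> * norm x" using N(2)[OF x] \<Lambda> by (intro mult_left_mono) auto
      ultimately show "L' x \<le> (C + \<Lambda>) * norm x" by (simp add: L'_def distrib_right)
    qed (use c' cC \<Lambda> in auto)
  next
    fix x y assume xy: "x \<in> U" "y \<in> U"
    have "\<Lambda> * N (x + y) \<le> \<Lambda> * (N x + N y)"
      using seminorm_onD(2)[OF N(1) xy] \<Lambda> by (intro mult_left_mono) auto
    then show "L' (x + y) \<le> L' x + L' y"
      using Ladd[OF \<pi>(1)[of x] \<pi>(1)[of y]] by (simp add: L'_def \<pi>(3) distrib_left)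
  next
    fix M x assume M: "M \<in> S" and x: "x \<in> U"
    have LN: "0 \<le> L (\<pi> x)" using cC(1) cC(3)[OF \<pi>(1)[of x]] by (meson mult_nonneg_nonneg norm_ge_zero order_trans less_imp_le)
    have Mx: "M *v x = M *v \<pi> x + M *v (x - \<pi> x)" by (simp add: algebra_simps)
    \<comment> \<open>\<open>M *v \<pi> x\<close> stays in the invariant subspace \<open>W\<close>,
      where \<open>\<pi>\<close> is the identity; the second summand is the off-diagonal
      block.\<close>
    have "L (\<pi> (M *v x)) \<le> L (M *v \<pi> x) + L (\<pi> (M *v (x - \<pi> x)))"
      unfolding Mx \<pi>(3) \<pi>W[OF invW[OF M \<pi>(1)]] by (intro Ladd \<pi>(1) invW M)
    also have "L (M *v \<pi> x) \<le> g * L (\<pi> x)" by (intro LS M \<pi>(1))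
    also have "L (\<pi> (M *v (x - \<pi> x))) \<le> D * N x"
    proof -
      have "L (\<pi> (M *v (x - \<pi> x))) \<le> C * norm (M *v (x - \<pi> x))"
        using cC(4)[OF \<pi>(1)] \<pi>(4) cC(2) by (meson mult_left_mono less_imp_le order_trans)
      also have "norm (M *v (x - \<pi> x)) \<le> norm M * norm (x - \<pi> x) * K" by (rule K)
      also have "\<dots> \<le> B * norm (x - \<pi> x) * K"
        using B(2)[OF M] K(1) by (intro mult_right_mono) auto
      also have "\<dots> \<le> B * (N x / b) * K"
        using B(1) K(1) b(1) b(2)[OF xZ[OF x]] Nz[OF x]
        by (intro mult_right_mono mult_left_mono) (auto simp: field_simps)
      finally show ?thesis using cC(2) by (simp add: D_def field_simps mult_left_mono)
    qed
    also have "D * N x \<le> (1 - \<kappa>) / 2 * \<Lambda> * N x" using D\<Lambda> N0[OF x] by (rule mult_right_mono)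
    finally have 1: "L (\<pi> (M *v x)) \<le> g * L (\<pi> x) + (1 - \<kappa>) / 2 * \<Lambda> * N x" by simp
    have 2: "\<Lambda> * N (M *v x) \<le> \<Lambda> * (\<kappa> * N x)" using N(3)[OF M x] \<Lambda> by (intro mult_left_mono) auto
    have "L' (M *v x) \<le> g * L (\<pi> x) + (1 - \<kappa>) / 2 * \<Lambda> * N x + \<Lambda> * (\<kappa> * N x)"
      using 1 2 unfolding L'_def by linarith
    also have "\<dots> = g * L (\<pi> x) + (1 + \<kappa>) / 2 * (\<Lambda> * N x)" by (simp add: field_simps)
    also have "\<dots> \<le> g' * L (\<pi> x) + g' * (\<Lambda> * N x)"
      using LN N0[OF x] \<Lambda> by (intro add_mono mult_right_mono) (auto simp: g'_def)
    finally show "L' (M *v x) \<le> g' * L' x" by (simp add: L'_def distrib_left)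
  qed
  then show thesis using L \<kappa> by (intro that[of g' L']) (auto simp: g'_def)
qed

text \<open>The \<open>F p\<close> are normalised afresh on each subspace of the induction: on the
  kernel of one limit the next limit is again nonzero somewhere, so the dimension drops strictly
  until the zero space is reached.\<close>

lemma adapted_bound_exists:
  fixes S :: "(real^'n^'n) set" and F :: "nat \<Rightarrow> real^'n \<Rightarrow> real"
  assumes S: "bounded S"
    and F: "\<And>p. seminorm_on UNIV (F p)" "\<And>p x. F p x \<le> C p * norm x" "\<And>p x. x \<noteq> 0 \<Longrightarrow> 0 < F p x"
    and near: "\<And>M e x. M \<in> S \<Longrightarrow> 0 < e \<Longrightarrow>
      \<forall>\<^sub>F p in sequentially. \<exists>A\<in>S. dist A M < e \<and> F p (A *v x) \<le> \<kappa> * F p x"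
    and \<kappa>: "0 \<le> \<kappa>" "\<kappa> < 1"
  shows "subspace U \<Longrightarrow> (\<forall>M\<in>S. \<forall>x\<in>U. M *v x \<in> U) \<Longrightarrow>
    \<exists>g L. 0 \<le> g \<and> g < 1 \<and> adapted_bound S U g L"
proof (induction "dim U" arbitrary: U rule: less_induct)
  case less
  note U = less.prems(1)
  have inv: "\<And>M x. M \<in> S \<Longrightarrow> x \<in> U \<Longrightarrow> M *v x \<in> U" using less.prems(2) by blast
  show ?case
  proof (cases "U = {0}")
    case True
    have "adapted_bound S U 0 norm"
      unfolding adapted_bound_def True by (auto intro!: exI[of _ 1])
    then show ?thesis by (intro exI[of _ 0] exI[of _ norm]) auto
  next
    case False
    have FU: "seminorm_on U (F p)" for p by (rule seminorm_on_subset[OF F(1)]) simp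
    have FC: "F p x \<le> C p * norm x" if "x \<in> U" for p x by (rule F(2))
    have Fpos: "0 < F p x" if "x \<in> U" "x \<noteq> 0" for p x using that(2) by (rule F(3))
    have nearU: "\<forall>\<^sub>F p in sequentially. \<exists>A\<in>S. dist A M < e \<and> F p (A *v x) \<le> \<kappa> * F p x"
      if "M \<in> S" "0 < e" "x \<in> U" for M e x
      using that(1,2) by (rule near)
    obtain s N where s: "\<And>p. 0 < s p" "\<And>p x. x \<in> U \<Longrightarrow> F p x \<le> s p * norm x"
      and N: "seminorm_on U N" "\<And>x. x \<in> U \<Longrightarrow> N x \<le> norm x" "\<exists>x\<in>U. N x \<noteq> 0"
      and up: "\<And>x c. x \<in> U \<Longrightarrow> N x < c \<Longrightarrow> \<forall>\<^sub>F p in sequentially. F p x \<le> s p * c"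
      and low: "\<And>x c. x \<in> U \<Longrightarrow> \<forall>\<^sub>F p in sequentially. F p x \<le> s p * c \<Longrightarrow> N x \<le> c"
      by (rule limit_seminorm[of U F C]) (rule U False FU FC Fpos that; assumption)+
    have contr: "N (M *v x) \<le> \<kappa> * N x" if "M \<in> S" "x \<in> U" for M x
      by (rule limit_seminorm_contraction[where F = F and S = S and s = s])
        (rule U inv FU nearU \<kappa>(1) s up low that; assumption)+
    define W where "W = {x\<in>U. N x = 0}"
    have N0: "0 \<le> N x" if "x \<in> U" for x by (rule seminorm_onD(1)[OF N(1) that])
    have W: "subspace W" unfolding W_def by (rule subspace_seminorm_kernel[OF N(1) U])
    have invW: "M *v x \<in> W" if "M \<in> S" "x \<in> W" for M x
      using that contr[of M x] N0[of "M *v x"] inv[of M x] by (auto simp: W_def)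
    have "W \<subset> U" using N(3) by (auto simp: W_def)
    then have "dim W < dim U" using W U by (metis dim_psubset span_eq_iff)
    then obtain g L where "0 \<le> g" "g < 1" "adapted_bound S W g L"
      using less.hyps[of W] W invW by blast
    then show ?thesis
      using adapted_bound_extend[OF U inv S N(1,2) contr \<kappa> W_def] by metis
  qed
qed

lemma absolutely_exponentially_stableI:
  assumes "adapted_bound S UNIV g L" "0 \<le> g" "g < 1"
  shows "absolutely_exponentially_stable S"
proof -
  obtain c C where cC: "0 < c" "0 < C" "\<And>x. c * norm x \<le> L x" "\<And>x. L x \<le> C * norm x"
    and L: "\<And>M x. M \<in> S \<Longrightarrow> L (M *v x) \<le> g * L x"
    using assms(1) unfolding adapted_bound_def by auto
  have "norm (x k) \<le> C / c * g ^ k * norm (x 0)" if t: "is_switched_trajectory S A x" for A x k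
  proof -
    have "L (x k) \<le> g ^ k * L (x 0)"
    proof (induction k)
      case (Suc k)
      have "L (x (Suc k)) \<le> g * L (x k)" using t L by (simp add: is_switched_trajectory_def)
      also have "\<dots> \<le> g * (g ^ k * L (x 0))" using Suc assms(2) by (rule mult_left_mono)
      finally show ?case by simp
    qed simp
    also have "\<dots> \<le> g ^ k * (C * norm (x 0))" using cC assms(2) by (intro mult_left_mono) auto
    finally have "c * norm (x k) \<le> g ^ k * (C * norm (x 0))" using cC(3) order_trans by blast
    then show ?thesis using cC(1) by (simp add: field_simps)
  qed
  then show ?thesis unfolding absolutely_exponentially_stable_def
    using cC assms by (intro exI[of _ "C / c"] exI[of _ g]) auto
qed

section \<open>The support of a measure\<close>

text \<open>The complement of the support is the union of all open null sets; by the Lindelof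
  property countably many of them already cover it.\<close>

lemma AE_support:
  fixes \<mu> :: "'a::second_countable_topology measure"
  assumes [measurable_cong]: "sets \<mu> = sets borel"
  shows "AE x in \<mu>. x \<in> support \<mu>"
proof -
  let ?N = "{U. open U \<and> emeasure \<mu> U = 0}"
  obtain \<F> where \<F>: "\<F> \<subseteq> ?N" "countable \<F>" "\<Union>\<F> = \<Union>?N"
    by (rule Lindelof[of ?N]) auto
  have "\<Union>\<F> \<in> null_sets \<mu>"
  proof (rule null_sets_UN'[of \<F> "\<lambda>U. U", simplified])
    show "countable \<F>" by (rule \<F>(2))
    show "U \<in> null_sets \<mu>" if "U \<in> \<F>" for U using that \<F>(1) assms by (intro null_setsI) auto
  qed
  moreover have "{x \<in> space \<mu>. x \<notin> support \<mu>} \<subseteq> \<Union>\<F>"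
    unfolding \<F>(3) by (auto simp: support_def zero_less_iff_neq_zero)
  ultimately show ?thesis by (rule AE_I')
qed

section \<open>The largest seminorm below a function, and its averages over events\<close>

text \<open>The values \<open>r\<close> are the sums of \<open>\<bar>t\<bar> * v y\<close> over
  finite decompositions of \<open>x\<close> into terms \<open>t *\<^sub>R y\<close>. As an inductive
  relation it lets an estimate for \<open>v\<close> pass to all decompositions by rule
  induction.\<close>

inductive atomic_cost :: "('a::real_vector \<Rightarrow> real) \<Rightarrow> 'a \<Rightarrow> real \<Rightarrow> bool" for v where
  atom: "atomic_cost v (t *\<^sub>R y) (\<bar>t\<bar> * v y)"
| add: "atomic_cost v x r \<Longrightarrow> atomic_cost v x' r' \<Longrightarrow> atomic_cost v (x + x') (r + r')"

text \<open>The largest seminorm below a nonnegative \<open>v\<close>.\<close>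

definition convex_gauge :: "('a::real_vector \<Rightarrow> real) \<Rightarrow> 'a \<Rightarrow> real" where
  "convex_gauge v x = Inf {r. atomic_cost v x r}"

lemma atomic_cost_self: "atomic_cost v x (v x)"
  using atomic_cost.atom[of v 1 x] by simp

lemma atomic_cost_scale: "atomic_cost v x r \<Longrightarrow> atomic_cost v (t *\<^sub>R x) (\<bar>t\<bar> * r)"
proof (induction rule: atomic_cost.induct)
  case (atom s y)
  then show ?case using atomic_cost.atom[of v "t * s" y] by (simp add: abs_mult mult.assoc)
qed (auto simp: scaleR_add_right distrib_left intro: atomic_cost.add)

text \<open>This bounds the set of costs from below, so its infimum is meaningful, and makes the
  gauge positive off 0 when \<open>c\<close> is positive.\<close>

lemma atomic_cost_ge:
  fixes x :: "'a::real_normed_vector"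
  assumes v: "\<And>y. c * norm y \<le> v y" and c: "0 \<le> c"
  shows "atomic_cost v x r \<Longrightarrow> c * norm x \<le> r"
proof (induction rule: atomic_cost.induct)
  case (atom t y)
  show ?case using mult_left_mono[OF v[of y], of "\<bar>t\<bar>"] by (simp add: mult.left_commute)
next
  case (add x r x' r')
  have "c * norm (x + x') \<le> c * (norm x + norm x')"
    using c by (intro mult_left_mono norm_triangle_ineq)
  with add.IH show ?case by (simp add: distrib_left)
qed

context
  fixes v :: "'a::real_normed_vector \<Rightarrow> real" and c :: real
  assumes v: "\<And>y. c * norm y \<le> v y" and c: "0 \<le> c"
begin

lemma convex_gauge_le: "atomic_cost v x r \<Longrightarrow> convex_gauge v x \<le> r"
  unfolding convex_gauge_def
  by (intro cInf_lower) (auto intro!: bdd_belowI[of _ "c * norm x"] atomic_cost_ge[OF v c])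

lemma convex_gauge_ge: "c * norm x \<le> convex_gauge v x"
  unfolding convex_gauge_def
  by (intro cInf_greatest) (auto intro: atomic_cost_ge[OF v c] atomic_cost_self)

lemma convex_gauge_approx:
  assumes "convex_gauge v x < s"
  obtains r where "atomic_cost v x r" "r < s"
  using cInf_lessD[of "{r. atomic_cost v x r}" s] assms atomic_cost_self[of v x]
  by (auto simp: convex_gauge_def)

lemma convex_gauge_nonneg: "0 \<le> convex_gauge v x"
  using convex_gauge_ge[of x] c by (meson mult_nonneg_nonneg norm_ge_zero order_trans)

lemma seminorm_convex_gauge: "seminorm_on UNIV (convex_gauge v)"
proof -
  let ?N = "convex_gauge v"
  have add: "?N (x + y) \<le> ?N x + ?N y" for x y
  proof (rule field_le_epsilon)
    fix e :: real assume e: "0 < e"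
    obtain r where r: "atomic_cost v x r" "r < ?N x + e / 2"
      using convex_gauge_approx[of x "?N x + e / 2"] e by auto
    obtain r' where r': "atomic_cost v y r'" "r' < ?N y + e / 2"
      using convex_gauge_approx[of y "?N y + e / 2"] e by auto
    show "?N (x + y) \<le> ?N x + ?N y + e"
      using convex_gauge_le[OF atomic_cost.add[OF r(1) r'(1)]] r r' by linarith
  qed
  have le: "?N (t *\<^sub>R x) \<le> \<bar>t\<bar> * ?N x" for t x
  proof (rule field_le_epsilon)
    fix e :: real assume e: "0 < e"
    obtain r where r: "atomic_cost v x r" "r < ?N x + e / (1 + \<bar>t\<bar>)"
      using convex_gauge_approx[of x "?N x + e / (1 + \<bar>t\<bar>)"] e by (auto simp: add_pos_nonneg)
    have "?N (t *\<^sub>R x) \<le> \<bar>t\<bar> * r" by (rule convex_gauge_le[OF atomic_cost_scale[OF r(1)]])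
    also have "\<dots> \<le> \<bar>t\<bar> * (?N x + e / (1 + \<bar>t\<bar>))" using r by (intro mult_left_mono) auto
    also have "\<dots> \<le> \<bar>t\<bar> * ?N x + e"
      using e by (simp add: distrib_left field_simps add_pos_nonneg)
    finally show "?N (t *\<^sub>R x) \<le> \<bar>t\<bar> * ?N x + e" .
  qed
  have "?N (t *\<^sub>R x) = \<bar>t\<bar> * ?N x" for t x
  proof (cases "t = 0")
    case True
    then show ?thesis using le[of 0 x] convex_gauge_nonneg[of 0] by simp
  next
    case False
    then show ?thesis using le[of t x] le[of "1 / t" "t *\<^sub>R x"] by (simp add: field_simps)
  qed
  with add convex_gauge_nonneg show ?thesis by (auto simp: seminorm_on_def)
qed

end

text \<open>Jensen's inequality for the \<open>p\<close>-th power on \<open>B\<close>, via Bernoulli.\<close>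

lemma nn_integral_power_mean:
  fixes f :: "'a \<Rightarrow> real"
  assumes M: "prob_space M" and f: "integrable M (\<lambda>A. f A ^ p)" "f \<in> borel_measurable M" "\<And>A. 0 \<le> f A"
    and B: "B \<in> sets M" and \<tau>: "0 < \<tau>" and p: "1 \<le> p"
    and le: "(LINT A|M. f A ^ p) \<le> \<tau> ^ p * measure M B"
  shows "(\<integral>\<^sup>+A\<in>B. ennreal (f A) \<partial>M) \<le> ennreal (measure M B * \<tau>)"
proof -
  interpret prob_space M by (rule M)
  \<comment> \<open>\<open>a + b * s ^ p\<close> touches the identity to first order at
    \<open>s = \<tau>\<close>; that it lies above the identity is Bernoulli's inequality for
    \<open>s / \<tau>\<close>, solved for \<open>s\<close>.\<close>
  define a where "a = \<tau> - \<tau> / p"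
  define b where "b = \<tau> / (p * \<tau> ^ p)"
  have ab: "0 \<le> a" "0 \<le> b" using \<tau> p by (auto simp: a_def b_def field_simps)
  have pt: "f A \<le> a + b * f A ^ p" for A
  proof -
    have "1 + real p * (f A / \<tau> - 1) \<le> (1 + (f A / \<tau> - 1)) ^ p"
      using f(3)[of A] \<tau> by (intro Bernoulli_inequality) auto
    then have "1 + real p * (f A / \<tau> - 1) \<le> f A ^ p / \<tau> ^ p" by (simp add: power_divide)
    then have "\<tau> / p * (1 + real p * (f A / \<tau> - 1)) \<le> \<tau> / p * (f A ^ p / \<tau> ^ p)"
      using \<tau> by (intro mult_left_mono) auto
    moreover have "\<tau> / p * (1 + real p * (f A / \<tau> - 1)) = f A - a"
      using \<tau> p by (simp add: a_def field_simps)
    ultimately show ?thesis by (simp add: b_def)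
  qed
  have "(\<integral>\<^sup>+A\<in>B. ennreal (f A) \<partial>M)
      \<le> (\<integral>\<^sup>+A. ennreal a * indicator B A + ennreal b * ennreal (f A ^ p) \<partial>M)"
  \<comment> \<open>Only the constant is restricted to \<open>B\<close>. The power is integrated
    over the whole space, where hypothesis \<open>le\<close> controls it.\<close>
  proof (rule nn_integral_mono)
    fix A
    show "ennreal (f A) * indicator B A \<le> ennreal a * indicator B A + ennreal b * ennreal (f A ^ p)"
      using pt[of A] ab f(3)[of A]
      by (auto simp: indicator_def ennreal_mult[symmetric] ennreal_plus[symmetric] simp del: ennreal_plus
          intro!: ennreal_leI)
  qed
  also have "\<dots> = ennreal a * emeasure M B + ennreal b * (\<integral>\<^sup>+A. ennreal (f A ^ p) \<partial>M)"
    using f(2) B by (subst nn_integral_add) (auto simp: nn_integral_cmult)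
  also have "(\<integral>\<^sup>+A. ennreal (f A ^ p) \<partial>M) = ennreal (LINT A|M. f A ^ p)"
    using f(1,3) by (intro nn_integral_eq_integral) auto
  also have "ennreal a * emeasure M B + ennreal b * \<dots> = ennreal (a * measure M B + b * (LINT A|M. f A ^ p))"
    using ab f(3) by (simp add: emeasure_eq_measure ennreal_mult[symmetric] ennreal_plus[symmetric] del: ennreal_plus)
  also have "\<dots> \<le> ennreal (measure M B * \<tau>)"
  proof (rule ennreal_leI)
    have "b * (LINT A|M. f A ^ p) \<le> b * (\<tau> ^ p * measure M B)" by (rule mult_left_mono[OF le ab(2)])
    also have "\<dots> = \<tau> / p * measure M B" using \<tau> p by (simp add: b_def)
    finally show "a * measure M B + b * (LINT A|M. f A ^ p) \<le> measure M B * \<tau>"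
      by (simp add: a_def algebra_simps)
  qed
  finally show ?thesis .
qed

lemma matrix_vector_mult_measurable:
  fixes N :: "real^'m \<Rightarrow> real" and \<mu> :: "(real^'n^'m) measure"
  assumes N: "continuous_on UNIV N" and \<mu>: "sets \<mu> = sets borel"
  shows "(\<lambda>A. N (A *v x)) \<in> borel_measurable \<mu>"
proof -
  have "continuous_on UNIV (\<lambda>A :: real^'n^'m. A *v x)"
    by (intro bounded_linear.continuous_on[OF
          bounded_bilinear.bounded_linear_left[OF bounded_bilinear_matrix_vector_mult]] continuous_on_id)
  then have "continuous_on UNIV (\<lambda>A :: real^'n^'m. N (A *v x))"
    by (intro continuous_on_compose2[OF N]) auto
  then show ?thesis
    using measurable_cong_sets[OF \<mu> refl] borel_measurable_continuous_onI by blast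
qed

text \<open>The gauge is subadditive and at most \<open>v\<close>, so the average estimate for
  \<open>v\<close> over \<open>B\<close> passes to every decomposition of \<open>x\<close>. A nearly
  optimal decomposition then makes the average of the gauge of \<open>A *v x\<close> smaller than
  \<open>\<kappa>\<close> times the gauge of \<open>x\<close>, so a suitable \<open>A\<close>
  exists, and it can be taken in the support, which has full measure.\<close>

lemma gauge_decrease_on_event:
  fixes \<mu> :: "(real^'n^'n) measure" and v :: "real^'n \<Rightarrow> real"
  assumes \<mu>: "prob_space \<mu>" "sets \<mu> = sets borel"
    and v: "\<And>y. c * norm y \<le> v y" "\<And>y. v y \<le> C * norm y" "0 < c"
    and int: "\<And>y. (\<integral>\<^sup>+A\<in>B. ennreal (v (A *v y)) \<partial>\<mu>) \<le> ennreal (measure \<mu> B * (\<kappa>\<^sub>0 * v y))"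
    and meas: "\<And>y. (\<lambda>A. v (A *v y)) \<in> borel_measurable \<mu>"
    and B: "B \<in> sets \<mu>" "0 < measure \<mu> B" and \<kappa>: "0 < \<kappa>\<^sub>0" "\<kappa>\<^sub>0 < \<kappa>"
  shows "\<exists>A\<in>B \<inter> support \<mu>. convex_gauge v (A *v x) \<le> \<kappa> * convex_gauge v x"
proof -
  interpret prob_space \<mu> by (rule \<mu>)
  let ?N = "convex_gauge v" and ?q = "measure \<mu> B"
  have c0: "0 \<le> c" using v(3) by simp
  note sn = seminorm_convex_gauge[OF v(1) c0] and nonneg = convex_gauge_nonneg[OF v(1) c0]
  have "?N y \<le> C * norm y" for y
    using convex_gauge_le[OF v(1) c0 atomic_cost_self] v(2) order_trans by blast
  then have cont: "continuous_on UNIV ?N"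
    using seminorm_on_continuous[OF sn] by auto
  note meas' = matrix_vector_mult_measurable[OF cont \<mu>(2)]
  have v0: "0 \<le> v y" for y using v(1)[of y] c0 by (meson mult_nonneg_nonneg norm_ge_zero order_trans)
  \<comment> \<open>Nonnegativity of \<open>r\<close> is proved in the same induction because adding
    the bounds in \<open>ennreal\<close> relies on it.\<close>
  have cost: "(\<integral>\<^sup>+A\<in>B. ennreal (?N (A *v y)) \<partial>\<mu>) \<le> ennreal (?q * (\<kappa>\<^sub>0 * r))" and r0: "0 \<le> r"
    if "atomic_cost v y r" for y r
    using that
  proof (induction rule: atomic_cost.induct)
    case (atom t y)
    {
      case 1
      have "(\<integral>\<^sup>+A\<in>B. ennreal (?N (A *v (t *\<^sub>R y))) \<partial>\<mu>)
          \<le> (\<integral>\<^sup>+A. ennreal \<bar>t\<bar> * (ennreal (v (A *v y)) * indicator B A) \<partial>\<mu>)"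
      proof (rule nn_integral_mono)
        fix A
        have "?N (A *v (t *\<^sub>R y)) \<le> \<bar>t\<bar> * v (A *v y)"
          unfolding matrix_vector_mult_scaleR by (rule convex_gauge_le[OF v(1) c0 atomic_cost.atom])
        then show "ennreal (?N (A *v (t *\<^sub>R y))) * indicator B A
            \<le> ennreal \<bar>t\<bar> * (ennreal (v (A *v y)) * indicator B A)"
          using v0[of "A *v y"] by (auto simp: indicator_def ennreal_mult[symmetric] intro!: ennreal_leI)
      qed
      also have "\<dots> = ennreal \<bar>t\<bar> * (\<integral>\<^sup>+A\<in>B. ennreal (v (A *v y)) \<partial>\<mu>)"
        using meas[of y] B by (intro nn_integral_cmult) auto
      also have "\<dots> \<le> ennreal \<bar>t\<bar> * ennreal (?q * (\<kappa>\<^sub>0 * v y))" by (intro mult_left_mono int) auto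
      also have "\<dots> = ennreal (?q * (\<kappa>\<^sub>0 * (\<bar>t\<bar> * v y)))"
        using v0[of y] \<kappa> by (simp add: ennreal_mult[symmetric] mult.left_commute)
      finally show ?case .
    next
      case 2
      show ?case using v0 by simp
    }
  next
    case (add y r y' r')
    {
      case 1
      have "(\<integral>\<^sup>+A\<in>B. ennreal (?N (A *v (y + y'))) \<partial>\<mu>)
          \<le> (\<integral>\<^sup>+A. ennreal (?N (A *v y)) * indicator B A + ennreal (?N (A *v y')) * indicator B A \<partial>\<mu>)"
      proof (rule nn_integral_mono)
        fix A
        show "ennreal (?N (A *v (y + y'))) * indicator B A
            \<le> ennreal (?N (A *v y)) * indicator B A + ennreal (?N (A *v y')) * indicator B A"
          using seminorm_onD(2)[OF sn, of "A *v y" "A *v y'"] nonneg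
          by (auto simp: indicator_def matrix_vector_right_distrib ennreal_plus[symmetric]
              simp del: ennreal_plus intro!: ennreal_leI)
      qed
      also have "\<dots> = (\<integral>\<^sup>+A\<in>B. ennreal (?N (A *v y)) \<partial>\<mu>) + (\<integral>\<^sup>+A\<in>B. ennreal (?N (A *v y')) \<partial>\<mu>)"
        using meas'[of y] meas'[of y'] B by (intro nn_integral_add) auto
      also have "\<dots> \<le> ennreal (?q * (\<kappa>\<^sub>0 * r)) + ennreal (?q * (\<kappa>\<^sub>0 * r'))" by (intro add_mono add.IH)
      also have "\<dots> = ennreal (?q * (\<kappa>\<^sub>0 * (r + r')))"
        using add.IH \<kappa> by (simp add: ennreal_plus[symmetric] distrib_left del: ennreal_plus)
      finally show ?case .
    next
      case 2
      show ?case using add.IH by simp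
    }
  qed
  have S: "AE A in \<mu>. A \<in> support \<mu>" by (rule AE_support[OF \<mu>(2)])
  show ?thesis
  proof (cases "x = 0")
    case True
    \<comment> \<open>At 0 the inequality is trivial, but a matrix must still be found:
      \<open>B\<close> has positive measure and so meets the support.\<close>
    have "\<exists>A. A \<in> B \<inter> support \<mu>"
    proof (rule ccontr)
      assume "\<not> ?thesis"
      with S have "AE A in \<mu>. A \<notin> B" by auto
      with B(2) show False by (simp flip: prob_eq_0[OF B(1)])
    qed
    then show ?thesis using True seminorm_on_zero[OF sn] by auto
  next
    case False
    then have Nx: "0 < ?N x" using convex_gauge_ge[OF v(1) c0, of x] v(3)
      by (meson less_le_trans mult_pos_pos zero_less_norm_iff)
    \<comment> \<open>The gap between \<open>\<kappa>\<^sub>0\<close> and \<open>\<kappa>\<close>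
      makes up for an infimum that may not be attained.\<close>
    then have "?N x < \<kappa> * ?N x / \<kappa>\<^sub>0" using \<kappa> by (simp add: field_simps)
    then obtain r where r: "atomic_cost v x r" "r < \<kappa> * ?N x / \<kappa>\<^sub>0"
      using convex_gauge_approx[OF v(1) c0] by blast
    show ?thesis
    proof (rule ccontr)
      assume "\<not> ?thesis"
      then have "AE A in \<mu>. A \<in> B \<longrightarrow> \<kappa> * ?N x \<le> ?N (A *v x)" using S by (auto simp: not_le less_imp_le)
      then have "(\<integral>\<^sup>+A\<in>B. ennreal (\<kappa> * ?N x) \<partial>\<mu>) \<le> (\<integral>\<^sup>+A\<in>B. ennreal (?N (A *v x)) \<partial>\<mu>)"
        by (intro nn_integral_mono_AE) (auto simp: indicator_def intro!: ennreal_leI)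
      also have "\<dots> \<le> ennreal (?q * (\<kappa>\<^sub>0 * r))" by (rule cost[OF r(1)])
      also have "(\<integral>\<^sup>+A\<in>B. ennreal (\<kappa> * ?N x) \<partial>\<mu>) = ennreal (?q * (\<kappa> * ?N x))"
        unfolding nn_integral_cmult_indicator[OF B(1)] emeasure_eq_measure
        using Nx \<kappa> by (subst ennreal_mult[symmetric]) (auto simp: mult.commute)
      finally have "?q * (\<kappa> * ?N x) \<le> ?q * (\<kappa>\<^sub>0 * r)"
        using r0[OF r(1)] \<kappa> B(2) Nx by (subst (asm) ennreal_le_iff) auto
      then show False using r(2) B(2) \<kappa> by (simp add: field_simps)
    qed
  qed
qed

text \<open>The gauge is taken of the \<open>p\<close>-th root of \<open>V\<close>, which is
  comparable with \<open>norm\<close>. The condition on \<open>B\<close> says that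
  \<open>\<gamma>\<close>, enlarged by the factor \<open>measure \<mu> B powr (-1/p)\<close> that
  restricting the mean to \<open>B\<close> costs, is still at most
  \<open>\<kappa>\<^sub>0\<close>.\<close>

lemma stochastic_lyapunov_gauge:
  fixes \<mu> :: "(real^'n^'n) measure"
  assumes \<mu>: "prob_space \<mu>" "sets \<mu> = sets borel"
    and V: "stochastic_lyapunov \<mu> p \<gamma>' V" and p: "1 \<le> p"
    and \<gamma>: "\<gamma>' \<le> \<gamma>" and \<kappa>: "0 < \<kappa>\<^sub>0" "\<kappa>\<^sub>0 < \<kappa>"
  shows "\<exists>N c C. seminorm_on UNIV N \<and> 0 < c \<and> (\<forall>x. c * norm x \<le> N x \<and> N x \<le> C * norm x) \<and>
    (\<forall>B\<in>sets \<mu>. \<gamma> ^ p \<le> \<kappa>\<^sub>0 ^ p * measure \<mu> B \<longrightarrow> 0 < measure \<mu> B \<longrightarrow>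
      (\<forall>x. \<exists>A\<in>B \<inter> support \<mu>. N (A *v x) \<le> \<kappa> * N x))"
proof -
  obtain C\<^sub>1 C\<^sub>2 where C: "0 < C\<^sub>1" "0 < C\<^sub>2" and \<gamma>': "0 \<le> \<gamma>'"
    and V: "\<And>x. C\<^sub>1 * norm x ^ p \<le> V x" "\<And>x. V x \<le> C\<^sub>2 * norm x ^ p"
      "\<And>x. integrable \<mu> (\<lambda>A. V (A *v x))" "\<And>x. (LINT A|\<mu>. V (A *v x)) \<le> \<gamma>' ^ p * V x"
    using V unfolding stochastic_lyapunov_def by blast
  have p0: "0 < p" using p by simp
  have V0: "0 \<le> V x" for x using V(1)[of x] C(1)
    by (meson mult_nonneg_nonneg norm_ge_zero zero_le_power less_imp_le order_trans)
  define v where "v x = root p (V x)" for x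
  have vp: "v x ^ p = V x" for x using V0 p0 by (simp add: v_def)
  have v0: "0 \<le> v x" for x using V0 p0 by (simp add: v_def real_root_ge_zero)
  have v1: "root p C\<^sub>1 * norm x \<le> v x" for x
    using real_root_le_mono[OF p0 V(1)[of x]] p0 by (simp add: v_def real_root_mult real_root_power_cancel)
  have v2: "v x \<le> root p C\<^sub>2 * norm x" for x
    using real_root_le_mono[OF p0 V(2)[of x]] p0 by (simp add: v_def real_root_mult real_root_power_cancel)
  have c: "0 < root p C\<^sub>1" using C p0 by simp
  have meas: "(\<lambda>A. v (A *v y)) \<in> borel_measurable \<mu>" for y
    using borel_measurable_integrable[OF V(3)[of y]] unfolding v_def by measurable
  have dec: "\<exists>A\<in>B \<inter> support \<mu>. convex_gauge v (A *v x) \<le> \<kappa> * convex_gauge v x"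
    if B: "B \<in> sets \<mu>" "\<gamma> ^ p \<le> \<kappa>\<^sub>0 ^ p * measure \<mu> B" "0 < measure \<mu> B" for B x
  proof (rule gauge_decrease_on_event[OF \<mu> v1 v2 c _ meas B(1,3) \<kappa>])
    fix y
    show "(\<integral>\<^sup>+A\<in>B. ennreal (v (A *v y)) \<partial>\<mu>) \<le> ennreal (measure \<mu> B * (\<kappa>\<^sub>0 * v y))"
    \<comment> \<open>The power mean estimate is applied with \<open>\<kappa>\<^sub>0 * v y\<close>
      as its bound, which must be positive.\<close>
    proof (cases "y = 0")
      case True
      have "v 0 = 0" using v2[of 0] v0[of 0] by simp
      then show ?thesis using True by simp
    next
      case False
      have "0 < v y" using v1[of y] c False by (meson less_le_trans mult_pos_pos zero_less_norm_iff)
      show ?thesis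
      proof (rule nn_integral_power_mean[OF \<mu>(1) _ meas v0 B(1) _ p])
        show "integrable \<mu> (\<lambda>A. v (A *v y) ^ p)" using V(3) by (simp add: vp)
        show "0 < \<kappa>\<^sub>0 * v y" using \<open>0 < v y\<close> \<kappa> by simp
        have "(LINT A|\<mu>. V (A *v y)) \<le> \<gamma>' ^ p * V y" by (rule V)
        also have "\<dots> \<le> \<gamma> ^ p * V y" using \<gamma> \<gamma>' V0 by (intro mult_right_mono power_mono) auto
        also have "\<dots> \<le> \<kappa>\<^sub>0 ^ p * measure \<mu> B * V y" using B V0 by (intro mult_right_mono) auto
        finally show "(LINT A|\<mu>. v (A *v y) ^ p) \<le> (\<kappa>\<^sub>0 * v y) ^ p * measure \<mu> B"
          by (simp add: vp power_mult_distrib mult_ac)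
      qed
    qed
  qed
  have c0: "0 \<le> root p C\<^sub>1" using c by simp
  have up: "convex_gauge v x \<le> root p C\<^sub>2 * norm x" for x
    using convex_gauge_le[OF v1 c0 atomic_cost_self[of v x]] v2[of x] by linarith
  show ?thesis
    by (rule exI[of _ "convex_gauge v"], rule exI[of _ "root p C\<^sub>1"], rule exI[of _ "root p C\<^sub>2"])
      (use seminorm_convex_gauge[OF v1 c0] c convex_gauge_ge[OF v1 c0] up dec in auto)
qed

section \<open>The two implications\<close>

lemma stable_if_stochastic_lyapunov:
  fixes \<mu> :: "(real^'n^'n) measure"
  assumes \<mu>: "prob_space \<mu>" "sets \<mu> = sets borel" and bdd: "bounded (support \<mu>)"
    and \<gamma>: "\<gamma> < 1" and V: "\<And>p. 1 \<le> p \<Longrightarrow> \<exists>\<gamma>'\<le>\<gamma>. \<exists>V. stochastic_lyapunov \<mu> p \<gamma>' V"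
  shows "absolutely_exponentially_stable (support \<mu>)"
proof -
  interpret prob_space \<mu> by (rule \<mu>)
  have \<gamma>0: "0 \<le> \<gamma>" using V[of 1] unfolding stochastic_lyapunov_def by auto
  define \<kappa>\<^sub>0 where "\<kappa>\<^sub>0 = (\<gamma> + 1) / 2"
  define \<kappa> where "\<kappa> = (\<kappa>\<^sub>0 + 1) / 2"
  \<comment> \<open>Two gaps below 1: from \<open>\<gamma>\<close> to
    \<open>\<kappa>\<^sub>0\<close> for the cost of restricting to a small ball, from
    \<open>\<kappa>\<^sub>0\<close> to \<open>\<kappa>\<close> for the infimum in the gauge.\<close>
  have \<kappa>: "\<gamma> < \<kappa>\<^sub>0" "0 < \<kappa>\<^sub>0" "\<kappa>\<^sub>0 < \<kappa>" "\<kappa> < 1" using \<gamma> \<gamma>0 by (auto simp: \<kappa>\<^sub>0_def \<kappa>_def)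
  \<comment> \<open>Degrees start at 1, so index \<open>p\<close> stands for degree
    \<open>Suc p\<close>.\<close>
  let ?P = "\<lambda>p N c C. seminorm_on UNIV N \<and> 0 < c \<and> (\<forall>x. c * norm x \<le> N x \<and> N x \<le> C * norm x) \<and>
    (\<forall>B\<in>sets \<mu>. \<gamma> ^ Suc p \<le> \<kappa>\<^sub>0 ^ Suc p * measure \<mu> B \<longrightarrow> 0 < measure \<mu> B \<longrightarrow>
      (\<forall>x. \<exists>A\<in>B \<inter> support \<mu>. N (A *v x) \<le> \<kappa> * N x))"
  have "\<forall>p. \<exists>N c C. ?P p N c C"
  proof
    fix p
    obtain \<gamma>' V' where "\<gamma>' \<le> \<gamma>" "stochastic_lyapunov \<mu> (Suc p) \<gamma>' V'" using V[of "Suc p"] by auto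
    then show "\<exists>N c C. ?P p N c C" by (intro stochastic_lyapunov_gauge[OF \<mu>, of "Suc p"] \<kappa>) auto
  qed
  from choice[OF this] obtain F where "\<forall>p. \<exists>c C. ?P p (F p) c C" ..
  from choice[OF this] obtain c where "\<forall>p. \<exists>C. ?P p (F p) (c p) C" ..
  from choice[OF this] obtain C where "\<forall>p. ?P p (F p) (c p) (C p)" ..
  then have P: "\<And>p. ?P p (F p) (c p) (C p)" ..
  have "\<exists>g L. 0 \<le> g \<and> g < 1 \<and> adapted_bound (support \<mu>) UNIV g L"
  proof (rule adapted_bound_exists[OF bdd, of F C \<kappa>])
    show "seminorm_on UNIV (F p)" for p using P by blast
    show "F p x \<le> C p * norm x" for p x using P by blast
    show "0 < F p x" if "x \<noteq> 0" for p x
    proof -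
      have "0 < c p * norm x" using P[of p] that by simp
      then show ?thesis using P[of p] less_le_trans by blast
    qed
    fix M e x assume M: "M \<in> support \<mu>" and e: "0 < (e :: real)"
    let ?q = "measure \<mu> (ball M e)"
    have B: "ball M e \<in> sets \<mu>" by (simp add: \<mu>)
    have "0 < emeasure \<mu> (ball M e)" using M e by (auto simp: support_def)
    then have q: "0 < ?q" by (simp add: emeasure_eq_measure)
    \<comment> \<open>However small the mass \<open>?q\<close> of the ball, it eventually exceeds
      these powers, and then the condition of the gauge lemma holds for the ball.\<close>
    have "(\<lambda>p. (\<gamma> / \<kappa>\<^sub>0) ^ Suc p) \<longlonglongrightarrow> 0"
      using \<kappa> \<gamma>0 by (intro LIMSEQ_Suc LIMSEQ_power_zero) auto
    then have "\<forall>\<^sub>F p in sequentially. (\<gamma> / \<kappa>\<^sub>0) ^ Suc p < ?q" using q by (rule order_tendstoD)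
    then show "\<forall>\<^sub>F p in sequentially. \<exists>A\<in>support \<mu>. dist A M < e \<and> F p (A *v x) \<le> \<kappa> * F p x"
    proof eventually_elim
      case (elim p)
      have "\<gamma> ^ Suc p < \<kappa>\<^sub>0 ^ Suc p * ?q"
        using elim \<kappa>(2) zero_less_power[OF \<kappa>(2), of "Suc p"]
        unfolding power_divide by (simp only: pos_divide_less_eq mult.commute)
      then obtain A where "A \<in> ball M e \<inter> support \<mu>" "F p (A *v x) \<le> \<kappa> * F p x"
        using P[of p] B q by (meson less_imp_le)
      then show ?case by (auto simp: dist_commute)
    qed
  qed (use \<kappa> in auto)
  then show ?thesis using absolutely_exponentially_stableI by blast
qed

lemma stable_adapted_seminorm:
  fixes S :: "(real^'n^'n) set"
  assumes S: "absolutely_exponentially_stable S" "S \<noteq> {}"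
  obtains g C W where "0 < g" "g < 1" "0 < C" "seminorm_on UNIV W"
    "\<And>x. norm x \<le> W x" "\<And>x. W x \<le> C * norm x" "\<And>M x. M \<in> S \<Longrightarrow> W (M *v x) \<le> g * W x"
proof -
  obtain C \<gamma> where C: "0 < C" "0 \<le> \<gamma>" "\<gamma> < 1"
    and st: "\<And>A x k. is_switched_trajectory S A x \<Longrightarrow> norm (x k) \<le> C * \<gamma> ^ k * norm (x 0)"
    using S(1) unfolding absolutely_exponentially_stable_def by blast
  \<comment> \<open>Any rate in \<open>[\<gamma>, 1)\<close> would do; the maximum with
    \<open>1 / 2\<close> keeps \<open>g\<close> positive, so that division by \<open>g ^ k\<close>
    makes sense.\<close>
  define g where "g = max \<gamma> (1 / 2)"
  have g: "0 < g" "g < 1" "\<gamma> \<le> g" using C by (auto simp: g_def)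
  define run where "run A x = rec_nat x (\<lambda>k y. (A k :: real^'n^'n) *v y)" for A and x :: "real^'n"
  have run_simps: "run A x 0 = x" "run A x (Suc k) = A k *v run A x k" for A x k
    by (auto simp: run_def)
  have run_add: "run A (x + y) k = run A x k + run A y k" for A x y k
    by (induction k) (auto simp: run_simps matrix_vector_right_distrib)
  have run_scale: "run A (t *\<^sub>R x) k = t *\<^sub>R run A x k" for A t x k
    by (induction k) (auto simp: run_simps matrix_vector_mult_scaleR)
  have run_shift: "run (case_nat M A) x (Suc k) = run A (M *v x) k" for M A x k
    by (induction k) (auto simp: run_simps)
  \<comment> \<open>The term with \<open>k = 0\<close> gives \<open>norm x \<le> W x\<close>, and
    the stability estimate with \<open>\<gamma> \<le> g\<close> bounds the set by
    \<open>C * norm x\<close>.\<close>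
  define T where "T x = {norm (run A x k) / g ^ k | A k. \<forall>i. A i \<in> S}" for x
  define W where "W x = Sup (T x)" for x
  have Tle: "r \<le> C * norm x" if r: "r \<in> T x" for r x
  proof -
    obtain A k where A: "\<forall>i. A i \<in> S" and r: "r = norm (run A x k) / g ^ k" using r by (auto simp: T_def)
    have "norm (run A x k) \<le> C * \<gamma> ^ k * norm x"
      using st[of A "run A x" k] A by (simp add: is_switched_trajectory_def run_simps)
    also have "\<dots> \<le> C * g ^ k * norm x"
      using C g by (intro mult_right_mono mult_left_mono power_mono) auto
    finally show ?thesis using g by (simp add: r field_simps)
  qed
  have bdd: "bdd_above (T x)" for x by (rule bdd_aboveI[OF Tle])
  obtain M0 where M0: "M0 \<in> S" using S(2) by blast
  have normT: "norm x \<in> T x" for x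
    unfolding T_def using M0 by (auto intro!: exI[of _ "\<lambda>_. M0"] exI[of _ 0] simp: run_simps)
  have up: "r \<le> W x" if "r \<in> T x" for r x unfolding W_def by (rule cSup_upper[OF that bdd])
  have least: "W x \<le> b" if "\<And>r. r \<in> T x \<Longrightarrow> r \<le> b" for x b
    unfolding W_def using normT that by (intro cSup_least) auto
  have nonneg: "0 \<le> W x" for x using up[OF normT[of x]] norm_ge_zero[of x] by linarith
  have upr: "norm (run A x k) \<le> W x * g ^ k" if "\<forall>i. A i \<in> S" for A x k
    using up[of "norm (run A x k) / g ^ k" x] that g by (auto simp: T_def field_simps)
  have add: "W (x + y) \<le> W x + W y" for x y
  proof (rule least)
    fix r assume "r \<in> T (x + y)"
    then obtain A k where A: "\<forall>i. A i \<in> S" and r: "r = norm (run A (x + y) k) / g ^ k" by (auto simp: T_def)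
    have "norm (run A (x + y) k) \<le> (W x + W y) * g ^ k"
      using upr[OF A, of x k] upr[OF A, of y k] norm_triangle_ineq[of "run A x k" "run A y k"]
      by (simp add: run_add distrib_right)
    then show "r \<le> W x + W y" using g by (simp add: r field_simps)
  qed
  have le: "W (t *\<^sub>R x) \<le> \<bar>t\<bar> * W x" for t x
  proof (rule least)
    fix r assume "r \<in> T (t *\<^sub>R x)"
    then obtain A k where A: "\<forall>i. A i \<in> S" and r: "r = norm (run A (t *\<^sub>R x) k) / g ^ k" by (auto simp: T_def)
    have "norm (run A (t *\<^sub>R x) k) \<le> \<bar>t\<bar> * (W x * g ^ k)"
      using upr[OF A, of x k] by (simp add: run_scale mult_left_mono)
    then show "r \<le> \<bar>t\<bar> * W x" using g by (simp add: r field_simps)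
  qed
  have scale: "W (t *\<^sub>R x) = \<bar>t\<bar> * W x" for t x
  proof (cases "t = 0")
    case True
    then show ?thesis using le[of 0 x] nonneg[of 0] by simp
  next
    case False
    then show ?thesis using le[of t x] le[of "1 / t" "t *\<^sub>R x"] by (simp add: field_simps)
  qed
  have contr: "W (M *v x) \<le> g * W x" if M: "M \<in> S" for M x
  proof (rule least)
    fix r assume "r \<in> T (M *v x)"
    then obtain A k where A: "\<forall>i. A i \<in> S" and r: "r = norm (run A (M *v x) k) / g ^ k" by (auto simp: T_def)
    \<comment> \<open>Prepending \<open>M\<close> turns a run from \<open>M *v x\<close> into a run
      from \<open>x\<close> that is one step longer; the extra step is the factor
      \<open>g\<close>.\<close>
    have "\<forall>i. case_nat M A i \<in> S" using A M by (auto split: nat.split)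
    from upr[OF this, of x "Suc k"] have "norm (run A (M *v x) k) \<le> W x * g ^ Suc k"
      by (simp only: run_shift)
    then show "r \<le> g * W x" using g by (simp add: r field_simps)
  qed
  show thesis
    using nonneg add scale up normT least Tle contr
    by (intro that[OF g(1,2) C(1), of W]) (auto simp: seminorm_on_def)
qed

text \<open>Almost every matrix lies in the support and contracts \<open>W\<close> by
  \<open>g\<close>, hence \<open>W x ^ p\<close> by \<open>g ^ p\<close>, and this passes to the
  mean. The same \<open>g\<close> serves every degree.\<close>

lemma stochastic_lyapunov_if_stable:
  fixes \<mu> :: "(real^'n^'n) measure"
  assumes \<mu>: "prob_space \<mu>" "sets \<mu> = sets borel"
    and st: "absolutely_exponentially_stable (support \<mu>)"
  shows "\<exists>\<gamma><1. \<forall>p. \<exists>V. stochastic_lyapunov \<mu> p \<gamma> V"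
proof -
  interpret prob_space \<mu> by (rule \<mu>)
  have S: "AE A in \<mu>. A \<in> support \<mu>" by (rule AE_support[OF \<mu>(2)])
  then have "support \<mu> \<noteq> {}" by auto
  then obtain g C W where g: "0 < g" "g < 1" and C: "0 < C" and W: "seminorm_on UNIV W"
    "\<And>x. norm x \<le> W x" "\<And>x. W x \<le> C * norm x" "\<And>M x. M \<in> support \<mu> \<Longrightarrow> W (M *v x) \<le> g * W x"
    using stable_adapted_seminorm[OF st] by metis
  have cont: "continuous_on UNIV W" using seminorm_on_continuous[OF W(1)] W(3) by auto
  have W0: "0 \<le> W x" for x using W(2)[of x] norm_ge_zero[of x] by linarith
  have "stochastic_lyapunov \<mu> p g (\<lambda>x. W x ^ p)" for p
  proof -
    have "norm x ^ p \<le> W x ^ p" for x using W(2) by (simp add: power_mono)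
    moreover have "W x ^ p \<le> C ^ p * norm x ^ p" for x
      using W(3)[of x] W0 by (simp add: power_mono flip: power_mult_distrib)
    moreover have ae: "AE A in \<mu>. W (A *v x) ^ p \<le> g ^ p * W x ^ p" for x
      using S by eventually_elim (simp add: W(4) W0 power_mono flip: power_mult_distrib)
    moreover have int: "integrable \<mu> (\<lambda>A. W (A *v x) ^ p)" for x
    proof (rule integrable_const_bound)
      show "AE A in \<mu>. norm (W (A *v x) ^ p) \<le> g ^ p * W x ^ p" using ae W0 by simp
      show "(\<lambda>A. W (A *v x) ^ p) \<in> borel_measurable \<mu>"
        using matrix_vector_mult_measurable[OF cont \<mu>(2)] by measurable
    qed
    moreover have "(LINT A|\<mu>. W (A *v x) ^ p) \<le> g ^ p * W x ^ p" for x
      using integral_mono_AE[OF int integrable_const ae] by (simp add: prob_space)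
    ultimately have "\<forall>x. 1 * norm x ^ p \<le> W x ^ p \<and> W x ^ p \<le> C ^ p * norm x ^ p \<and>
        integrable \<mu> (\<lambda>A. W (A *v x) ^ p) \<and> (LINT A|\<mu>. W (A *v x) ^ p) \<le> g ^ p * W x ^ p"
      by simp
    moreover have "0 < C ^ p" using C by simp
    ultimately show ?thesis
      unfolding stochastic_lyapunov_def using g zero_less_one less_imp_le by blast
  qed
  then show ?thesis using g by blast
qed

theorem theorem5p3:
  fixes \<mu> \<mu>\<^sub>s :: "(real^'n^'n) measure"
  assumes "prob_space \<mu>" and "sets \<mu> = sets borel"
    and "bounded (support \<mu>)"
    and "\<exists>K. proper_cone K \<and> (\<forall>M\<in>support \<mu>. (*v) M ` K \<subseteq> K)"
    and "is_singular_part \<mu> \<mu>\<^sub>s"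
    and "\<mu>\<^sub>s = null_measure borel \<or>
      (\<exists>(N::nat) (p :: nat \<Rightarrow> real) (M :: nat \<Rightarrow> real^'n^'n).
         (\<forall>i\<in>{1..N}. 0 < p i) \<and>
         (\<forall>A\<in>sets borel.
            emeasure \<mu>\<^sub>s A = (\<Sum>i=1..N. ennreal (p i) * emeasure (return borel (M i)) A)))"
  shows "absolutely_exponentially_stable (support \<mu>) \<longleftrightarrow>
    (\<exists>\<gamma><1. \<forall>p\<ge>1. \<exists>\<gamma>'\<le>\<gamma>. \<exists>V. stochastic_lyapunov \<mu> p \<gamma>' V)"
  \<comment> \<open>Stability gives one rate for all degrees, so \<open>order_refl\<close> settles
    \<open>\<gamma>' \<le> \<gamma>\<close> with \<open>\<gamma>' = \<gamma>\<close>.\<close>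
  using stochastic_lyapunov_if_stable[OF assms(1,2)] stable_if_stochastic_lyapunov[OF assms(1-3)]
  by (metis order_refl)

end
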